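(* Let $n\geq 2$ be an integer and, for each integer $m\in\{0,1,\ldots,n\}$, let $q_m:=P\big(B(n,m/n)\leq m\big)$, where $B(n,m/n)$ denotes a binomial random variable with parameters $n$ and $m/n$. Then: (i) as $m$ ranges over $\{0,\ldots,n\}$, $q_m$ is minimum for $m=[\![2n/3]\!]$, that is, $q_{[\![2n/3]\!]}\leq q_m$ for every $m\in\{0,\ldots,n\}$; (ii) for every $m\in\{0,\ldots,n-1\}$, $q_m\geq q_{m+1}$ if and only if $m+\frac12<\frac{2n}{3}$.
   Context: $[\![x]\!]$ denotes the integer nearest to $x$ (for integer $n$, $2n/3$ is never a half-integer, so $[\![2n/3]\!]$ is unambiguous). A binomial random variable $B(n,p)$ with parameters $n$ and $p\in[0,1]$ satisfies $P(B(n,p)=k)=\binom{n}{k}p^k(1-p)^{n-k}$ for $k=0,\ldots,n$, with the convention $0^0=1$. *)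

theory Defs
  imports "HOL-Probability.Probability"
begin

(* The probability that a binomial variable with parameters n and m/n is at most m;
   meaningful only for 0 < n and m \<le> n, since binomial_pmf is specified only for a
   parameter in [0,1]. *)
definition binom_le_mean :: "nat \<Rightarrow> nat \<Rightarrow> real" where
  "binom_le_mean n m = measure_pmf.prob (binomial_pmf n (real m / real n)) {k. k \<le> m}"

(* round breaks ties upwards, but 2 * n / 3 is never a half-integer. *)
definition nearest_two_thirds :: "nat \<Rightarrow> nat" where
  "nearest_two_thirds n = nat (round (2 * real n / 3))"

end

theory Submission
  imports Defs
begin

text \<open>
  Write \<open>n = a + b + 1\<close> and compare \<open>q\<^sub>a\<close> with \<open>q\<^sub>a\<^sub>+\<^sub>1\<close>, where
  \<open>q\<^sub>m = P(B(n, m/n) \<le> m)\<close>. Passing from \<open>a\<close> to \<open>a + 1\<close> adds the term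
  \<open>P(B(n, (a+1)/n) = a + 1)\<close> and moves the success probability from \<open>a/n\<close> to
  \<open>(a+1)/n\<close>. The latter change is an integral, because the derivative of
  \<open>P(B(n, p) \<le> a)\<close> in \<open>p\<close> telescopes to the single term
  \<open>- n (n-1 choose a) p^a (1-p)^b\<close>. After the substitution \<open>p = (a + 1 - u)/n\<close> all binomial
  coefficients and powers of \<open>n\<close> cancel, and \<open>q\<^sub>a \<ge> q\<^sub>a\<^sub>+\<^sub>1\<close> becomes
  (\<open>scaled_beta_primitive\<close>)

    \<open>\<integral>\<^sub>0\<^sup>1 (1 - u/(a+1))^a (b+u)^b du \<ge> b^b\<close>.

  The integrand decreases with \<open>a\<close> pointwise (\<open>scaled_beta_antimono\<close>), and
  \<open>a + 1/2 < 2n/3\<close> means \<open>a \<le> 2b\<close> for integers. Hence only two borderline cases remain: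
  the inequality must hold for \<open>a = 2b\<close> and fail for \<open>a = 2b + 1\<close>. What makes
  both tractable is that for \<open>a = 2b\<close> the integrand is the \<open>b\<close>-th power of the cubic
  \<open>(1 - u/(2b+1))\<^sup>2 (b+u) = b + z(u)\<close>, and for \<open>a = 2b + 1\<close> it is such a power times one further
  linear factor.

  For \<open>a = 2b\<close>, Bernoulli's inequality \<open>(b+z)^b \<ge> b^b (1+z)\<close> is enough: it remains that
  \<open>z\<close> has positive mean, and the mean is \<open>1 / (12 (2b+1)\<^sup>2)\<close>
  (\<open>descent_le_double\<close>). For \<open>a = 2b + 1\<close>, put \<open>t = 1/(2b+2)\<close> and write the cubic as
  \<open>b + x(u)\<close>; then \<open>(b+x)^b \<le> b^b e^x \<le> b^b (1 + x + x\<^sup>2)\<close>. Since \<open>x\<close> is of order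
  \<open>t\<close>, the errors committed are of order \<open>t\<^sup>2\<close>, the same order as the true deficit, but small
  enough: the integral of the resulting polynomial is below \<open>b^b\<close> by about
  \<open>(11/120) t\<^sup>2 b^b\<close> (\<open>ascent_gt_double\<close>).

  Thus \<open>q\<close> decreases exactly up to the integer nearest to \<open>2n/3\<close> and increases from there on.
\<close>

section \<open>The binomial distribution function\<close>

definition binom_cdf :: "nat \<Rightarrow> nat \<Rightarrow> real \<Rightarrow> real" where
  "binom_cdf n m p = (\<Sum>k\<le>m. real (n choose k) * p ^ k * (1 - p) ^ (n - k))"

lemma binom_le_mean_eq_cdf:
  assumes "0 < n" "m \<le> n"
  shows "binom_le_mean n m = binom_cdf n m (real m / real n)"
proof -
  have "{k. k \<le> m} = {..m}" by auto
  moreover have "0 \<le> real m / real n" "real m / real n \<le> 1" using assms by auto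
  ultimately show ?thesis
    unfolding binom_le_mean_def binom_cdf_def
    by (simp add: measure_measure_pmf_finite)
qed

text \<open>
  The sum of the derivatives of the individual terms telescopes: the positive part of the
  derivative of the \<open>(m+1)\<close>-st term cancels what the terms up to \<open>m\<close> contribute and its
  negative part takes over.
\<close>

lemma binom_cdf_has_derivative:
  assumes "m < n"
  shows "(binom_cdf n m has_real_derivative
           - (real n * real ((n - 1) choose m) * p ^ m * (1 - p) ^ (n - 1 - m))) (at p)"
  using assms
proof (induction m)
  case 0
  then show ?case
    unfolding binom_cdf_def by (auto intro!: derivative_eq_intros)
next
  case (Suc m)
  define c where "c = real (n choose Suc m)"
  have split: "binom_cdf n (Suc m) = (\<lambda>p. binom_cdf n m p + c * p ^ Suc m * (1 - p) ^ (n - Suc m))"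
    by (simp add: binom_cdf_def c_def fun_eq_iff)
  obtain N where N: "n = Suc N" using Suc.prems by (cases n) auto
  have low: "c * real (Suc m) = real n * real ((n - 1) choose m)"
    unfolding c_def N of_nat_mult [symmetric] by (simp only: mult.commute Suc_times_binomial_eq diff_Suc_1)
  have high: "c * real (n - Suc m) = real n * real ((n - 1) choose Suc m)"
    unfolding c_def of_nat_mult [symmetric]
    using binomial_absorb_comp [of n "Suc m"] by (simp only: mult.commute)
  have e: "n - 1 - m = n - Suc m" "n - Suc m - 1 = n - 1 - Suc m" by auto
  have "(binom_cdf n (Suc m) has_real_derivative
      - (real n * real ((n - 1) choose m) * p ^ m * (1 - p) ^ (n - 1 - m))
      + (c * real (Suc m) * p ^ m * (1 - p) ^ (n - Suc m)
         - c * real (n - Suc m) * p ^ Suc m * (1 - p) ^ (n - Suc m - 1))) (at p)"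
    unfolding split
  proof (rule DERIV_add)
    show "(binom_cdf n m has_real_derivative
      - (real n * real ((n - 1) choose m) * p ^ m * (1 - p) ^ (n - 1 - m))) (at p)"
      using Suc by simp
    have "((\<lambda>p. p ^ Suc m) has_real_derivative real (Suc m) * p ^ m) (at p)"
      using DERIV_pow [of "Suc m" p] by simp
    moreover have "((\<lambda>p. (1 - p) ^ k) has_real_derivative - (real k * (1 - p) ^ (k - 1))) (at p)"
      for k by (auto intro!: derivative_eq_intros)
    ultimately show "((\<lambda>p. c * p ^ Suc m * (1 - p) ^ (n - Suc m)) has_real_derivative
        c * real (Suc m) * p ^ m * (1 - p) ^ (n - Suc m)
         - c * real (n - Suc m) * p ^ Suc m * (1 - p) ^ (n - Suc m - 1)) (at p)"
      by - (rule DERIV_cong [OF DERIV_mult [OF DERIV_cmult]], auto simp: algebra_simps)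
  qed
  then show ?case
    unfolding low high e by simp
qed

section \<open>Consecutive values as a comparison of an average with an endpoint value\<close>

text \<open>
  Up to a constant factor this is the Beta density \<open>p^a (1-p)^b\<close> at \<open>p = (a + 1 - u) / n\<close> with
  \<open>n = a + b + 1\<close>. The first factor is divided by its value at \<open>u = 0\<close>, as this makes the
  dependence on \<open>a\<close> monotone; the second is left undivided so that \<open>b = 0\<close> is covered.
\<close>

definition scaled_beta :: "nat \<Rightarrow> nat \<Rightarrow> real \<Rightarrow> real" where
  "scaled_beta a b u = (1 - u / (real a + 1)) ^ a * (real b + u) ^ b"

text \<open>
  The reparametrised distribution function is a primitive of \<open>scaled_beta\<close>; its value at
  \<open>u = 1\<close> gives \<open>q\<^sub>a\<close>, and its value at \<open>u = 0\<close> gives \<open>q\<^sub>a\<^sub>+\<^sub>1\<close> without the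
  additional term \<open>P(B(n, (a+1)/n) = a + 1)\<close>, which scales to \<open>b^b\<close>. Stating this with
  a primitive instead of an integral lets bounds on the density be integrated by comparing
  derivatives.
\<close>

lemma scaled_beta_primitive:
  obtains K where
    "\<And>u. (K has_real_derivative scaled_beta a b u) (at u)"
    "binom_le_mean (a + b + 1) a \<ge> binom_le_mean (a + b + 1) (a + 1)
       \<longleftrightarrow> K 1 - K 0 \<ge> real b ^ b"
proof -
  define n where "n = a + b + 1"
  define c where "c = real ((a + b) choose a) * (real a + 1) ^ a / real n ^ (a + b)"
  define K where "K u = binom_cdf n a ((real a + 1 - u) / real n) / c" for u
  have n: "real n > 0" "real n = real a + real b + 1" by (auto simp: n_def)
  have c: "c > 0" unfolding c_def using n by simp
  have deriv: "(K has_real_derivative scaled_beta a b u) (at u)" for u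
  proof -
    let ?p = "(real a + 1 - u) / real n"
    have p: "?p = (real a + 1) * (1 - u / (real a + 1)) / real n"
            "1 - ?p = (real b + u) / real n"
      using n by (simp_all add: diff_divide_distrib right_diff_distrib add_divide_distrib add.commute)
        (simp add: divide_simps)
    have "((\<lambda>u. (real a + 1 - u) / real n) has_real_derivative - 1 / real n) (at u)"
      using n(1) by (auto intro!: derivative_eq_intros simp: field_simps)
    moreover have "a < n" by (simp add: n_def)
    ultimately have "(K has_real_derivative
        - (real n * real ((n - 1) choose a) * ?p ^ a * (1 - ?p) ^ (n - 1 - a)) * (- 1 / real n) / c) (at u)"
      unfolding K_def by - (rule DERIV_cdivide, rule DERIV_chain2 [OF binom_cdf_has_derivative])
    also have "- (real n * real ((n - 1) choose a) * ?p ^ a * (1 - ?p) ^ (n - 1 - a)) * (- 1 / real n)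
                = c * scaled_beta a b u"
      unfolding p(2) unfolding p(1) c_def scaled_beta_def using n(1)
      by (simp add: n_def power_mult_distrib power_divide power_add)
    finally show ?thesis using c by simp
  qed
  have "binom_le_mean n a = c * K 1"
    using c binom_le_mean_eq_cdf [of n a] by (simp add: K_def n_def)
  moreover have "binom_le_mean n (a + 1) = c * K 0 + c * real b ^ b"
  proof -
    have "real (n choose Suc a) * (real a + 1) = real n * real ((a + b) choose a)"
      using Suc_times_binomial_eq [of "a + b" a]
      by (metis Suc_eq_plus1 n_def of_nat_Suc of_nat_mult add.commute)
    moreover have "1 - (real a + 1) / real n = real b / real n"
      using n by (simp add: field_simps)
    moreover have "n - Suc a = b" by (simp add: n_def)
    moreover have "real n ^ n = real n * real n ^ (a + b)" by (simp add: n_def)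
    ultimately have "real (n choose Suc a) * ((real a + 1) / real n) ^ Suc a
        * (1 - (real a + 1) / real n) ^ (n - Suc a) = c * real b ^ b"
      using n by (simp add: c_def power_divide power_add divide_simps)
    then show ?thesis
      using c binom_le_mean_eq_cdf [of n "a + 1"]
      by (simp add: K_def binom_cdf_def n_def add.commute)
  qed
  ultimately have "binom_le_mean n a \<ge> binom_le_mean n (a + 1) \<longleftrightarrow> c * (real b ^ b) \<le> c * (K 1 - K 0)"
    by (auto simp: algebra_simps)
  then have "binom_le_mean n a \<ge> binom_le_mean n (a + 1) \<longleftrightarrow> K 1 - K 0 \<ge> real b ^ b"
    using c by simp
  with deriv show thesis using that unfolding n_def by blast
qed

lemma increment_mono:
  fixes f g :: "real \<Rightarrow> real"
  assumes "\<And>u. (f has_real_derivative f' u) (at u)"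
      and "\<And>u. (g has_real_derivative g' u) (at u)"
      and "\<And>u. 0 \<le> u \<Longrightarrow> u \<le> 1 \<Longrightarrow> f' u \<le> g' u"
  shows "f 1 - f 0 \<le> g 1 - g 0"
proof -
  have "g 0 - f 0 \<le> g 1 - f 1"
  proof (rule DERIV_nonneg_imp_nondecreasing [of 0 1 "\<lambda>u. g u - f u"])
    fix u :: real assume "0 \<le> u" "u \<le> 1"
    then show "\<exists>y. ((\<lambda>u. g u - f u) has_real_derivative y) (at u) \<and> 0 \<le> y"
      using assms by (intro exI [of _ "g' u - f' u"]) (auto intro: DERIV_diff)
  qed simp
  then show ?thesis by simp
qed

text \<open>
  With \<open>p\<close> and \<open>r\<close> the bases on the left and right, \<open>p^(a+1) \<le> r^a\<close> says
  \<open>p \<le> (r/p)^a\<close>. Here \<open>r/p\<close> is slightly below 1, and Bernoulli's inequality for it loses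
  little enough.
\<close>

lemma power_ratio_antimono_step:
  fixes u :: real
  assumes "0 \<le> u" "u \<le> 1"
  shows "(1 - u / (real (Suc a) + 1)) ^ Suc a \<le> (1 - u / (real a + 1)) ^ a"
proof -
  define p where "p = 1 - u / (real a + 2)"
  define r where "r = 1 - u / (real a + 1)"
  define \<delta> where "\<delta> = u / ((real a + 1) * (real a + 2))"
  have p: "p > 0" using assms by (simp add: p_def field_simps)
  have r: "r = p - \<delta>"
    unfolding p_def r_def \<delta>_def by (simp add: divide_simps) (simp add: algebra_simps)
  have r0: "r \<ge> 0" using assms by (simp add: r_def field_simps)
  have ap: "real a \<le> (real a + 1) * p"
    using assms mult_left_mono [of u 1 "real a + 1"] by (simp add: p_def field_simps)
  have "real a * \<delta> \<le> p * (1 - p)"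
  proof -
    have "real a * \<delta> = real a * (u / (real a + 2)) / (real a + 1)"
      by (simp add: \<delta>_def)
    also have "\<dots> \<le> ((real a + 1) * p) * (u / (real a + 2)) / (real a + 1)"
      using ap assms by (intro divide_right_mono mult_right_mono) auto
    also have "\<dots> = p * (u / (real a + 2))" by simp
    also have "\<dots> = p * (1 - p)" by (simp add: p_def)
    finally show ?thesis .
  qed
  then have "p \<le> 1 + real a * (- \<delta> / p)"
    using p by (simp add: field_simps)
  also have "\<dots> \<le> (1 + (- \<delta> / p)) ^ a"
    using p r r0 by (intro Bernoulli_inequality) (simp add: field_simps)
  also have "1 + (- \<delta> / p) = r / p"
    using p r by (simp add: field_simps)
  finally have "p ^ Suc a \<le> r ^ a"
    using p by (simp add: power_divide field_simps)
  then show ?thesis by (simp add: p_def r_def add.commute)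
qed

lemma scaled_beta_antimono:
  assumes "0 \<le> u" "u \<le> 1" "a \<le> a'"
  shows "scaled_beta a' b u \<le> scaled_beta a b u"
proof -
  have "(1 - u / (real a' + 1)) ^ a' \<le> (1 - u / (real a + 1)) ^ a"
    using \<open>a \<le> a'\<close>
  proof (induction rule: dec_induct)
    case (step k)
    then show ?case using power_ratio_antimono_step [OF assms(1,2), of k] by linarith
  qed simp
  then show ?thesis
    unfolding scaled_beta_def using assms by (intro mult_right_mono) auto
qed

section \<open>The two critical cases\<close>

text \<open>
  The bracket on the left is \<open>1 + z(u)\<close>, where \<open>b + z(u)\<close> is the cubic
  \<open>(1 - s u)\<^sup>2 (b + u)\<close> whose \<open>b\<close>-th power is the scaled density.
\<close>

lemma scaled_beta_double_ge:
  assumes "0 \<le> u" "u \<le> 1" "b > 0" and s: "s = 1 / (2 * real b + 1)"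
  shows "real b ^ b * (1 + (s * u - (3 / 2 * s + 1 / 2 * s\<^sup>2) * u\<^sup>2 + s\<^sup>2 * u ^ 3)) \<le> scaled_beta (2 * b) b u"
proof -
  define z where "z = s * u - (3 / 2 * s + 1 / 2 * s\<^sup>2) * u\<^sup>2 + s\<^sup>2 * u ^ 3"
  \<comment> \<open>This relation between \<open>b\<close> and \<open>s\<close> turns the cubic into \<open>b\<close> plus a polynomial in \<open>s\<close> and \<open>u\<close>.\<close>
  have b: "2 * (real b * s) = 1 - s" using s by (simp add: field_simps)
  have z: "(1 - s * u)\<^sup>2 * (real b + u) = real b + z"
    using b unfolding z_def by algebra
  have "0 \<le> (1 - s * u)\<^sup>2 * (real b + u)" using assms by simp
  then have "-1 \<le> z / real b" unfolding z using \<open>b > 0\<close> by (simp add: field_simps)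
  then have "1 + real b * (z / real b) \<le> (1 + z / real b) ^ b"
    by (rule Bernoulli_inequality)
  then have "real b ^ b * (1 + z) \<le> real b ^ b * (1 + z / real b) ^ b"
    using \<open>b > 0\<close> by simp
  also have "\<dots> = (real b + z) ^ b"
    using \<open>b > 0\<close> by (simp add: power_mult_distrib [symmetric] distrib_left)
  also have "\<dots> = scaled_beta (2 * b) b u"
    unfolding scaled_beta_def z [symmetric] s by (simp add: power_mult_distrib power_mult)
  finally show ?thesis unfolding z_def .
qed

text \<open>
  The primitive \<open>f\<close> of the Bernoulli lower bound grows by \<open>b^b (1 + s\<^sup>2/12)\<close> over \<open>[0, 1]\<close>.
  For \<open>b = 0\<close> that bound is false, as \<open>0^0 = 1\<close>, but then \<open>a = 0\<close> and the scaled density is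
  constantly 1.
\<close>

lemma descent_le_double:
  assumes "a \<le> 2 * b"
  shows "binom_le_mean (a + b + 1) a \<ge> binom_le_mean (a + b + 1) (a + 1)"
proof -
  obtain K where K: "\<And>u. (K has_real_derivative scaled_beta a b u) (at u)"
    and iff: "binom_le_mean (a + b + 1) a \<ge> binom_le_mean (a + b + 1) (a + 1)
       \<longleftrightarrow> K 1 - K 0 \<ge> real b ^ b"
    using scaled_beta_primitive by blast
  have "K 1 - K 0 \<ge> real b ^ b"
  proof (cases "b = 0")
    case True
    then have "scaled_beta a b u = 1" for u using assms by (simp add: scaled_beta_def)
    then have "1 - 0 \<le> K 1 - K 0"
      using K by (intro increment_mono [of "\<lambda>u. u" "\<lambda>_. 1" K "scaled_beta a b"]) auto
    then show ?thesis using True by simp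
  next
    case False
    define s where "s = 1 / (2 * real b + 1)"
    define f where "f u = real b ^ b * (u + (s * u\<^sup>2 / 2 - (s / 2 + s\<^sup>2 / 6) * u ^ 3 + s\<^sup>2 * u ^ 4 / 4))"
      for u
    have f: "(f has_real_derivative
        real b ^ b * (1 + (s * u - (3 / 2 * s + 1 / 2 * s\<^sup>2) * u\<^sup>2 + s\<^sup>2 * u ^ 3))) (at u)" for u
      unfolding f_def
      by (auto intro!: derivative_eq_intros simp: field_simps power2_eq_square power3_eq_cube)
    have "f 1 - f 0 \<le> K 1 - K 0"
    proof (rule increment_mono [OF f K])
      fix u :: real assume u: "0 \<le> u" "u \<le> 1"
      show "real b ^ b * (1 + (s * u - (3 / 2 * s + 1 / 2 * s\<^sup>2) * u\<^sup>2 + s\<^sup>2 * u ^ 3)) \<le> scaled_beta a b u"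
        using scaled_beta_double_ge [OF u _ s_def] scaled_beta_antimono [OF u assms, of b] False by fastforce
    qed
    moreover have "f 1 - f 0 = real b ^ b * (1 + s\<^sup>2 / 12)"
      by (simp add: f_def field_simps)
    moreover have "\<dots> \<ge> real b ^ b" by (simp add: algebra_simps)
    ultimately show ?thesis by linarith
  qed
  with iff show ?thesis by simp
qed

text \<open>
  For negative \<open>x\<close> this follows from \<open>e^x \<le> 1/(1-x)\<close> and \<open>(1 + x + x\<^sup>2)(1 - x) = 1 - x\<^sup>3 \<ge> 1\<close>.
\<close>

lemma exp_le_quadratic:
  fixes x :: real
  assumes "x \<le> 1"
  shows "exp x \<le> 1 + x + x\<^sup>2"
proof (cases "0 \<le> x")
  case True
  then show ?thesis using exp_bound assms by simp
next
  case False
  have "1 - x \<le> exp (- x)" using exp_ge_add_one_self [of "- x"] by simp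
  then have "exp x \<le> 1 / (1 - x)" using False by (simp add: exp_minus field_simps)
  also have "\<dots> \<le> 1 + x + x\<^sup>2"
  proof -
    have "(1 + x + x\<^sup>2) * (1 - x) = 1 - x ^ 3" by algebra
    moreover have "x ^ 3 \<le> 0" using False by (simp add: power_le_zero_eq)
    ultimately show ?thesis using False by (simp add: divide_le_eq)
  qed
  finally show ?thesis .
qed

lemma power_add_le_exp:
  fixes x :: real
  assumes "0 \<le> real b + x"
  shows "(real b + x) ^ b \<le> real b ^ b * exp x"
proof (cases "b = 0")
  case True
  then show ?thesis using assms by simp
next
  case False
  have "(real b + x) ^ b = real b ^ b * (1 + x / real b) ^ b"
    using False by (simp add: power_mult_distrib [symmetric] distrib_left)
  also have "\<dots> \<le> real b ^ b * exp (x / real b) ^ b"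
    using assms False
    by (intro mult_left_mono power_mono exp_ge_add_one_self) (auto simp: field_simps)
  also have "\<dots> = real b ^ b * exp x"
    using False by (simp add: exp_of_nat_mult [symmetric])
  finally show ?thesis .
qed

text \<open>
  The odd exponent \<open>2b + 1\<close> leaves one factor \<open>1 - t u\<close> beside the \<open>b\<close>-th power of the
  cubic \<open>(1 - t u)\<^sup>2 (b + u) = b + x\<close>. That factor has to be kept in front of \<open>1 + x\<close>,
  where it decides the sign, but can be dropped in front of \<open>x\<^sup>2\<close>.
\<close>

lemma scaled_beta_Suc_double_le:
  assumes u: "0 \<le> u" "u \<le> 1" and t: "t = 1 / (2 * real b + 2)"
    and x: "x = 2 * t * u - (3 / 2 * t + t\<^sup>2) * u\<^sup>2 + t\<^sup>2 * u ^ 3"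
  shows "scaled_beta (2 * b + 1) b u \<le> real b ^ b * ((1 - t * u) * (1 + x) + x\<^sup>2)"
proof -
  have t01: "0 < t" "t \<le> 1" using t by auto
  have tu: "0 \<le> t * u" "t * u \<le> 1" using t01 u by (auto intro: mult_le_one)
  have b: "2 * (real b * t) = 1 - 2 * t" using t by (simp add: field_simps)
  have bx: "(1 - t * u)\<^sup>2 * (real b + u) = real b + x"
    using b unfolding x by algebra
  \<comment> \<open>The cubic lies in \<open>[0, b + u]\<close>, so \<open>x\<close> stays in the range of both exponential bounds.\<close>
  have nonneg: "0 \<le> real b + x" unfolding bx [symmetric] using u by simp
  have "(1 - t * u)\<^sup>2 \<le> 1" using tu by (simp add: power_le_one)
  then have "real b + x \<le> real b + u"
    unfolding bx [symmetric] using u by (intro mult_left_le_one_le) auto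
  then have "x \<le> 1" using u by simp
  have "scaled_beta (2 * b + 1) b u = (1 - t * u) * ((1 - t * u)\<^sup>2 * (real b + u)) ^ b"
    unfolding scaled_beta_def t by (simp add: power_mult_distrib power_mult add.commute)
  also have "\<dots> \<le> (1 - t * u) * (real b ^ b * exp x)"
    unfolding bx using power_add_le_exp [OF nonneg] tu by (intro mult_left_mono) auto
  also have "\<dots> = real b ^ b * ((1 - t * u) * exp x)" by simp
  also have "\<dots> \<le> real b ^ b * ((1 - t * u) * (1 + x) + x\<^sup>2)"
  proof (rule mult_left_mono)
    have "(1 - t * u) * exp x \<le> (1 - t * u) * (1 + x + x\<^sup>2)"
      using exp_le_quadratic [OF \<open>x \<le> 1\<close>] tu by (intro mult_left_mono) auto
    also have "\<dots> = (1 - t * u) * (1 + x) + x\<^sup>2 - (t * u) * x\<^sup>2" by algebra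
    also have "\<dots> \<le> (1 - t * u) * (1 + x) + x\<^sup>2" using tu by simp
    finally show "(1 - t * u) * exp x \<le> (1 - t * u) * (1 + x) + x\<^sup>2" .
  qed simp
  finally show ?thesis .
qed

text \<open>
  Here \<open>g\<close> is the primitive of the polynomial upper bound, and the growth of \<open>g\<close> over
  \<open>[0, 1]\<close> falls short of \<open>b^b\<close> by the factor
  \<open>1 - t\<^sup>2 (11/120 + t/20 - t\<^sup>2/105)\<close>. The contributions of order \<open>t\<close> cancel: they come
  from \<open>x\<close>, whose leading part \<open>t (2u - 3u\<^sup>2/2)\<close> has mean \<open>t/2\<close>, and from
  \<open>- t u\<close>.
\<close>

lemma ascent_gt_double:
  assumes "a > 2 * b"
  shows "binom_le_mean (a + b + 1) a < binom_le_mean (a + b + 1) (a + 1)"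
proof -
  obtain K where K: "\<And>u. (K has_real_derivative scaled_beta a b u) (at u)"
    and iff: "binom_le_mean (a + b + 1) a \<ge> binom_le_mean (a + b + 1) (a + 1)
       \<longleftrightarrow> K 1 - K 0 \<ge> real b ^ b"
    using scaled_beta_primitive by blast
  define t where "t = 1 / (2 * real b + 2)"
  define x where "x u = 2 * t * u - (3 / 2 * t + t\<^sup>2) * u\<^sup>2 + t\<^sup>2 * u ^ 3" for u
  define B where "B = - (3 / 2 * t + t\<^sup>2)"
  define g where "g u = real b ^ b * (u + t * u\<^sup>2 / 2 + B * u ^ 3 / 3 + t\<^sup>2 * u ^ 4 / 4
      - t * (2 * t * u ^ 3 / 3 + B * u ^ 4 / 4 + t\<^sup>2 * u ^ 5 / 5)
      + (4 * t\<^sup>2 * u ^ 3 / 3 + t * B * u ^ 4 + (B\<^sup>2 + 4 * t ^ 3) * u ^ 5 / 5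
         + B * t\<^sup>2 * u ^ 6 / 3 + t ^ 4 * u ^ 7 / 7))" for u
  have g: "(g has_real_derivative real b ^ b * ((1 - t * u) * (1 + x u) + (x u)\<^sup>2)) (at u)" for u
  proof -
    have "(g has_real_derivative real b ^ b * (1 + t * u + B * u\<^sup>2 + t\<^sup>2 * u ^ 3
      - t * (2 * t * u\<^sup>2 + B * u ^ 3 + t\<^sup>2 * u ^ 4)
      + (4 * t\<^sup>2 * u\<^sup>2 + 4 * t * B * u ^ 3 + (B\<^sup>2 + 4 * t ^ 3) * u ^ 4
         + 2 * B * t\<^sup>2 * u ^ 5 + t ^ 4 * u ^ 6))) (at u)"
      unfolding g_def
      by (rule derivative_eq_intros refl | simp)+
    also have "1 + t * u + B * u\<^sup>2 + t\<^sup>2 * u ^ 3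
      - t * (2 * t * u\<^sup>2 + B * u ^ 3 + t\<^sup>2 * u ^ 4)
      + (4 * t\<^sup>2 * u\<^sup>2 + 4 * t * B * u ^ 3 + (B\<^sup>2 + 4 * t ^ 3) * u ^ 4
         + 2 * B * t\<^sup>2 * u ^ 5 + t ^ 4 * u ^ 6) = (1 - t * u) * (1 + x u) + (x u)\<^sup>2"
      unfolding x_def B_def by algebra
    finally show ?thesis .
  qed
  have "K 1 - K 0 \<le> g 1 - g 0"
  proof (rule increment_mono [OF K g])
    fix u :: real assume u: "0 \<le> u" "u \<le> 1"
    have "scaled_beta a b u \<le> scaled_beta (2 * b + 1) b u"
      using scaled_beta_antimono [OF u] assms by simp
    also have "\<dots> \<le> real b ^ b * ((1 - t * u) * (1 + x u) + (x u)\<^sup>2)"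
      using scaled_beta_Suc_double_le [OF u t_def x_def] .
    finally show "scaled_beta a b u \<le> real b ^ b * ((1 - t * u) * (1 + x u) + (x u)\<^sup>2)" .
  qed
  also have "g 1 - g 0 = real b ^ b * (1 - t\<^sup>2 * (11 / 120 + t / 20 - t\<^sup>2 / 105))"
    unfolding g_def B_def by (simp add: field_simps power2_eq_square power3_eq_cube power4_eq_xxxx)
  also have "\<dots> < real b ^ b"
  proof -
    have "0 < t" "t \<le> 1" by (auto simp: t_def)
    then have "t\<^sup>2 \<le> 1" by (simp add: power_le_one)
    then have "0 < t\<^sup>2 * (11 / 120 + t / 20 - t\<^sup>2 / 105)"
      using \<open>0 < t\<close> by (intro mult_pos_pos) auto
    moreover have "0 < real b ^ b" by (cases "b = 0") auto
    ultimately show ?thesis by simp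
  qed
  finally show ?thesis using iff by simp
qed

section \<open>The minimum\<close>

lemma binom_le_mean_descent_iff:
  assumes "m < n"
  shows "binom_le_mean n m \<ge> binom_le_mean n (m + 1) \<longleftrightarrow> real m + 1 / 2 < 2 * real n / 3"
proof -
  define b where "b = n - 1 - m"
  have n: "n = m + b + 1" using assms by (simp add: b_def)
  have "binom_le_mean n m \<ge> binom_le_mean n (m + 1) \<longleftrightarrow> m \<le> 2 * b"
    using descent_le_double [of m b] ascent_gt_double [of b m] unfolding n by fastforce
  also have "\<dots> \<longleftrightarrow> real m + 1 / 2 < 2 * real n / 3"
    unfolding n by auto
  finally show ?thesis .
qed

text \<open>
  By definition of rounding the left side means \<open>m + 1/2 \<le> 2n/3\<close>; equality would say
  \<open>6m + 3 = 4n\<close>, which parity excludes.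
\<close>

lemma less_nearest_two_thirds_iff:
  "m < nearest_two_thirds n \<longleftrightarrow> real m + 1 / 2 < 2 * real n / 3"
proof -
  have "m < nearest_two_thirds n \<longleftrightarrow> real m + 1 \<le> 2 * real n / 3 + 1 / 2"
    unfolding nearest_two_thirds_def round_def zless_nat_eq_int_zless
    by (simp add: less_floor_iff)
  also have "\<dots> \<longleftrightarrow> 6 * m + 3 \<le> 4 * n" by auto
  also have "\<dots> \<longleftrightarrow> 6 * m + 3 < 4 * n" by presburger
  also have "\<dots> \<longleftrightarrow> real m + 1 / 2 < 2 * real n / 3" by auto
  finally show ?thesis .
qed

lemma nearest_two_thirds_le: "nearest_two_thirds n \<le> n"
  using less_nearest_two_thirds_iff [of n n] by linarith

theorem theorem1:
  fixes n :: nat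
  assumes "n \<ge> 2"
  shows "nearest_two_thirds n \<in> {0..n} \<and>
         (\<forall>m\<in>{0..n}. binom_le_mean n (nearest_two_thirds n) \<le> binom_le_mean n m) \<and>
         (\<forall>m\<in>{0..n-1}. binom_le_mean n m \<ge> binom_le_mean n (m + 1)
             \<longleftrightarrow> real m + 1 / 2 < 2 * real n / 3)"
proof (intro conjI ballI)
  let ?r = "nearest_two_thirds n"
  show "?r \<in> {0..n}" using nearest_two_thirds_le by simp
  have descent: "binom_le_mean n m \<ge> binom_le_mean n (Suc m) \<longleftrightarrow> m < ?r" if "m < n" for m
    using binom_le_mean_descent_iff [OF that] less_nearest_two_thirds_iff [of m n] by simp
  show "binom_le_mean n ?r \<le> binom_le_mean n m" if "m \<in> {0..n}" for m
  proof (cases "m \<le> ?r")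
    case True
    then show ?thesis
    proof (induction rule: inc_induct)
      case (step k)
      then show ?case using descent [of k] nearest_two_thirds_le [of n] by simp
    qed simp
  next
    case False
    have "binom_le_mean n ?r \<le> binom_le_mean n k" if "?r \<le> k" "k \<le> m" for k
      using that
    proof (induction rule: dec_induct)
      case (step k)
      then show ?case using descent [of k] \<open>m \<in> {0..n}\<close> by simp
    qed simp
    from this [of m] show ?thesis using False by simp
  qed
  show "binom_le_mean n m \<ge> binom_le_mean n (m + 1) \<longleftrightarrow> real m + 1 / 2 < 2 * real n / 3"
    if "m \<in> {0..n-1}" for m
    using binom_le_mean_descent_iff [of m n] that assms by simp
qed

end
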